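(* Consider one step, from time $t^n$ to $t^{n+1}=t^n+\Delta t$, of the stochastic Galerkin (sG) Vlasov transport step for $N$ particles: given the coefficients $\hat x^n_{i,h},\hat v^n_{i,h}\in\mathbb{R}$ ($i=1,\dots,N$, $h=0,\dots,M$) and the cell values $E^{n+1/2,M}_\ell(\mathbf z)$ ($\ell=1,\dots,N_\ell$) of the electric field returned by the Poisson solver, for all $i$ and $h$ $$\hat x^{n+1/2}_{i,h}=\hat x^n_{i,h}+\tfrac{\Delta t}{2}\,\hat v^n_{i,h},$$ $$\hat v^{n+1}_{i,h}=\hat v^n_{i,h}+\Delta t\sum_{\ell=1}^{N_\ell}\int_\Omega E^{n+1/2,M}_\ell(\mathbf z)\,\chi\big(x^{n+1/2,M}_i(\mathbf z)\in I_\ell\big)\,\Psi_h(\mathbf z)\,p(\mathbf z)\,d\mathbf z,$$ $$\hat x^{n+1}_{i,h}=\hat x^{n+1/2}_{i,h}+\tfrac{\Delta t}{2}\,\hat v^{n+1}_{i,h},$$ where the integral over $\Omega$ in the velocity update is evaluated by a Gauss quadrature rule with nodes $\mathbf z_1,\dots,\mathbf z_K\in\Omega$ and weights $w_1,\dots,w_K$, i.e. it is replaced by $\sum_{k=1}^K w_k\,E^{n+1/2,M}_\ell(\mathbf z_k)\,\chi\big(x^{n+1/2,M}_i(\mathbf z_k)\in I_\ell\big)\,\Psi_h(\mathbf z_k)$. Suppose that the Poisson solver is such that $$\sum_{\ell=1}^{N_\ell}E^{n+1/2,M}_\ell(\mathbf z)\,\rho^{n+1/2,M}_\ell(\mathbf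 z)=0$$ at each quadrature (collocation) node $\mathbf z=\mathbf z_k$, $k=1,\dots,K$. Then the step conserves the total momentum, that is, $$\frac{m(\mathbf z)}{N}\sum_{i=1}^N v^{n+1,M}_i(\mathbf z)=\frac{m(\mathbf z)}{N}\sum_{i=1}^N v^{n,M}_i(\mathbf z)\qquad\text{for all }\mathbf z\in\Omega.$$
   Context: Setting and notation. $\mathbf z$ is a random vector with values in $\Omega\subset\mathbb{R}^{d_z}$ and probability density $p(\mathbf z)$. $\{\Psi_h\}_{h=0}^M$ is a family of polynomials of degree at most $M$, orthonormal with respect to $p(\mathbf z)\,d\mathbf z$: $\int_\Omega\Psi_h\Psi_k\,p\,d\mathbf z=\delta_{hk}$. The spatial domain is an interval $I\subset\mathbb{R}$, partitioned into $N_\ell$ pairwise disjoint, equally spaced cells $I_1,\dots,I_{N_\ell}$ with union $I$. $\chi(\cdot)$ denotes the indicator function (1 if the condition holds, 0 otherwise). $\Delta t>0$ is the time step. The $N$ particles have positions and velocities represented by generalized polynomial chaos expansions: for $s\in\{n,n+1/2,n+1\}$, $$x^{s,M}_i(\mathbf z)=\sum_{h=0}^M\hat x^s_{i,h}\Psi_h(\mathbf z),$$ and for $s\in\{n,n+1\}$, $$v^{s,M}_i(\mathbf z)=\sum_{h=0}^M\hat v^s_{i,h}\Psi_h(\mathbf z).$$ $m(\mathbf z)>0$ is the (uncertain, time-independent) total mass, and each particle carries the weight $m(\mathbf z)/N$, so the empirical distribution is $\frac{m(\mathbf z)}{N}\sum_{i=1}^N\delta(x-x^{n,M}_i(\mathbf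 z))\otimes\delta(v-v^{n,M}_i(\mathbf z))$; the total momentum at time $t^n$ is its first velocity moment $\frac{m(\mathbf z)}{N}\sum_{i=1}^N v_i^{n,M}(\mathbf z)$. The local mass in cell $I_\ell$ at the half step is $$\rho^{n+1/2,M}_\ell(\mathbf z)=\frac{m(\mathbf z)}{N}\sum_{i=1}^N\chi\big(x^{n+1/2,M}_i(\mathbf z)\in I_\ell\big).$$ $E^{n+1/2,M}_\ell(\mathbf z)\in\mathbb{R}$ is the value in cell $I_\ell$ of the electric field at the half step, obtained from the local masses $\rho^{n+1/2,M}_\ell(\mathbf z)$ by a mesh-based solver for the Poisson equation, applied separately at each quadrature node; the only property of the solver that is assumed is the one stated in the claim. *)

theory Defs
  imports "HOL-Probability.Probability"
begin

lemma finite_multi_indices: "finite {\<alpha> :: 'd::finite \<Rightarrow> nat. (\<Sum>j\<in>UNIV. \<alpha> j) \<le> n}"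
proof (rule finite_subset)
  show "{\<alpha> :: 'd \<Rightarrow> nat. (\<Sum>j\<in>UNIV. \<alpha> j) \<le> n} \<subseteq> (\<Pi>\<^sub>E j\<in>UNIV. {..n})"
  proof
    fix \<alpha> :: "'d \<Rightarrow> nat" assume *: "\<alpha> \<in> {\<alpha>. (\<Sum>j\<in>UNIV. \<alpha> j) \<le> n}"
    have "\<alpha> j \<le> n" for j
      using member_le_sum[of j UNIV \<alpha>] * by simp
    then show "\<alpha> \<in> (\<Pi>\<^sub>E j\<in>UNIV. {..n})"
      by (simp add: PiE_iff)
  qed
  show "finite ((\<Pi>\<^sub>E j\<in>UNIV. {..n}) :: ('d \<Rightarrow> nat) set)"
    by (rule finite_PiE) simp_all
qed

(* Polynomial functions in the coordinates of z, of total degree at most n. *)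
definition poly_degree_le :: "nat \<Rightarrow> (real ^ 'd \<Rightarrow> real) \<Rightarrow> bool" where
  "poly_degree_le n f \<longleftrightarrow>
     (\<exists>c :: ('d \<Rightarrow> nat) \<Rightarrow> real. \<forall>z.
        f z = (\<Sum>\<alpha> | (\<Sum>j\<in>UNIV. \<alpha> j) \<le> n. c \<alpha> * (\<Prod>j\<in>UNIV. (z $ j) ^ \<alpha> j)))"

definition orthonormal_polys ::
  "(real ^ 'd) set \<Rightarrow> (real ^ 'd \<Rightarrow> real) \<Rightarrow> nat \<Rightarrow> (nat \<Rightarrow> real ^ 'd \<Rightarrow> real) \<Rightarrow> bool" where
  "orthonormal_polys \<Omega> p M \<Psi> \<longleftrightarrow>
     (\<forall>h\<le>M. poly_degree_le M (\<Psi> h)) \<and>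
     (\<forall>h\<le>M. \<forall>k\<le>M.
        set_integrable lborel \<Omega> (\<lambda>z. \<Psi> h z * \<Psi> k z * p z) \<and>
        (LINT z:\<Omega>|lborel. \<Psi> h z * \<Psi> k z * p z) = (if h = k then 1 else 0))"

(* The cells are indexed from left to right; each may contain either, both or none
   of its end points, as long as together they partition I. *)
definition equispaced_cells :: "real set \<Rightarrow> nat \<Rightarrow> (nat \<Rightarrow> real set) \<Rightarrow> bool" where
  "equispaced_cells I L cell \<longleftrightarrow>
     is_interval I \<and> (\<Union>l\<in>{1..L}. cell l) = I \<and> disjoint_family_on cell {1..L} \<and>
     (\<exists>a dx. 0 < dx \<and> (\<forall>l\<in>{1..L}.
        {a + (real l - 1) * dx<..<a + real l * dx} \<subseteq> cell l \<and>
        cell l \<subseteq> {a + (real l - 1) * dx..a + real l * dx}))"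

definition quadrature ::
  "nat \<Rightarrow> (nat \<Rightarrow> real ^ 'd) \<Rightarrow> (nat \<Rightarrow> real) \<Rightarrow> (real ^ 'd \<Rightarrow> real) \<Rightarrow> real" where
  "quadrature K \<zeta> w f = (\<Sum>k=1..K. w k * f (\<zeta> k))"

(* The weight function p is absorbed into the weights w.  In one variable, a Gauss rule with
   K nodes is one that is exact up to degree 2K - 1.  In several variables a rule of order n
   (tensorised, or a Gaussian cubature) need not have n nodes, so that the relation between
   n and K is left open there and only exactness up to total degree 2n - 1 is required. *)
definition gauss_rule ::
  "(real ^ 'd) set \<Rightarrow> (real ^ 'd \<Rightarrow> real) \<Rightarrow> nat \<Rightarrow> (nat \<Rightarrow> real ^ 'd) \<Rightarrow> (nat \<Rightarrow> real) \<Rightarrow> bool" where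
  "gauss_rule \<Omega> p K \<zeta> w \<longleftrightarrow>
     (\<forall>k\<in>{1..K}. \<zeta> k \<in> \<Omega>) \<and>
     (\<exists>n\<ge>1. (CARD('d) = 1 \<longrightarrow> n = K) \<and>
        (\<forall>f. poly_degree_le (2 * n - 1) f \<longrightarrow>
           set_integrable lborel \<Omega> (\<lambda>z. f z * p z) \<and>
           quadrature K \<zeta> w f = (LINT z:\<Omega>|lborel. f z * p z)))"

definition gpc :: "nat \<Rightarrow> (nat \<Rightarrow> real ^ 'd \<Rightarrow> real) \<Rightarrow> (nat \<Rightarrow> real) \<Rightarrow> real ^ 'd \<Rightarrow> real" where
  "gpc M \<Psi> c z = (\<Sum>h=0..M. c h * \<Psi> h z)"

(* Below, x i h and v i h are the h-th expansion coefficients of particle i. *)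
definition local_mass ::
  "(real ^ 'd \<Rightarrow> real) \<Rightarrow> nat \<Rightarrow> nat \<Rightarrow> (nat \<Rightarrow> real ^ 'd \<Rightarrow> real) \<Rightarrow> (nat \<Rightarrow> real set) \<Rightarrow>
   (nat \<Rightarrow> nat \<Rightarrow> real) \<Rightarrow> nat \<Rightarrow> real ^ 'd \<Rightarrow> real" where
  "local_mass m N M \<Psi> cell x l z =
     m z / real N * (\<Sum>i=1..N. indicator (cell l) (gpc M \<Psi> (x i) z))"

definition total_momentum ::
  "(real ^ 'd \<Rightarrow> real) \<Rightarrow> nat \<Rightarrow> nat \<Rightarrow> (nat \<Rightarrow> real ^ 'd \<Rightarrow> real) \<Rightarrow>
   (nat \<Rightarrow> nat \<Rightarrow> real) \<Rightarrow> real ^ 'd \<Rightarrow> real" where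
  "total_momentum m N M \<Psi> v z = m z / real N * (\<Sum>i=1..N. gpc M \<Psi> (v i) z)"

(* (x, v) are the coefficients at the old time, x' those of the half-step positions and
   (x'', v'') the coefficients at the new time. *)
definition sg_transport_step ::
  "real \<Rightarrow> nat \<Rightarrow> nat \<Rightarrow> (nat \<Rightarrow> real ^ 'd \<Rightarrow> real) \<Rightarrow> nat \<Rightarrow> (nat \<Rightarrow> real set) \<Rightarrow>
   nat \<Rightarrow> (nat \<Rightarrow> real ^ 'd) \<Rightarrow> (nat \<Rightarrow> real) \<Rightarrow> (nat \<Rightarrow> real ^ 'd \<Rightarrow> real) \<Rightarrow>
   (nat \<Rightarrow> nat \<Rightarrow> real) \<Rightarrow> (nat \<Rightarrow> nat \<Rightarrow> real) \<Rightarrow> (nat \<Rightarrow> nat \<Rightarrow> real) \<Rightarrow>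
   (nat \<Rightarrow> nat \<Rightarrow> real) \<Rightarrow> (nat \<Rightarrow> nat \<Rightarrow> real) \<Rightarrow> bool" where
  "sg_transport_step dt N M \<Psi> L cell K \<zeta> w E x v x' x'' v'' \<longleftrightarrow>
     (\<forall>i\<in>{1..N}. \<forall>h\<in>{0..M}.
        x' i h = x i h + dt / 2 * v i h \<and>
        v'' i h = v i h + dt * (\<Sum>l=1..L.
          quadrature K \<zeta> w (\<lambda>z. E l z * indicator (cell l) (gpc M \<Psi> (x' i) z) * \<Psi> h z)) \<and>
        x'' i h = x' i h + dt / 2 * v'' i h)"

end

theory Submission
  imports Defs
begin

text \<open>Sum the velocity update over all particles for a fixed mode \<open>h\<close>. Since the
  quadrature is a finite sum, the particle sum can be moved inside
  (\<open>sum_quadrature_swap\<close>): at each node the increment is a node-dependent factor times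
  the total force, i.e. the field weighted by the particle counts of the cells. Up to the factor
  \<open>m z / real N\<close>, these counts are the local masses, so the assumption on the solver
  makes the total force vanish at every node. Hence each modal sum of velocities is conserved. The
  total momentum depends on the velocities only through these sums
  (\<open>total_momentum_eq\<close>), so it is conserved at every z, although the assumption
  concerns the nodes alone.\<close>

text \<open>The factor \<open>g\<close> (later a basis polynomial) depends on neither particle nor
  cell, so it leaves both sums; what remains at a node is the force summed over particles.\<close>

lemma sum_quadrature_swap:
  "(\<Sum>i\<in>A. \<Sum>l\<in>B. quadrature K \<zeta> w (\<lambda>z. E l z * f i l z * g z)) =
     (\<Sum>k=1..K. w k * g (\<zeta> k) * (\<Sum>l\<in>B. E l (\<zeta> k) * (\<Sum>i\<in>A. f i l (\<zeta> k))))"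
proof -
  have "(\<Sum>i\<in>A. \<Sum>l\<in>B. quadrature K \<zeta> w (\<lambda>z. E l z * f i l z * g z)) =
      (\<Sum>i\<in>A. \<Sum>k=1..K. \<Sum>l\<in>B. w k * (E l (\<zeta> k) * f i l (\<zeta> k) * g (\<zeta> k)))"
    unfolding quadrature_def by (intro sum.cong refl sum.swap)
  also have "\<dots> = (\<Sum>k=1..K. \<Sum>i\<in>A. \<Sum>l\<in>B. w k * (E l (\<zeta> k) * f i l (\<zeta> k) * g (\<zeta> k)))"
    by (rule sum.swap)
  also have "\<dots> = (\<Sum>k=1..K. \<Sum>l\<in>B. \<Sum>i\<in>A. w k * (E l (\<zeta> k) * f i l (\<zeta> k) * g (\<zeta> k)))"
    by (intro sum.cong refl sum.swap)
  also have "\<dots> = (\<Sum>k=1..K. w k * g (\<zeta> k) * (\<Sum>l\<in>B. E l (\<zeta> k) * (\<Sum>i\<in>A. f i l (\<zeta> k))))"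
    by (simp add: sum_distrib_left mult_ac)
  finally show ?thesis .
qed

lemma total_momentum_eq:
  "total_momentum m N M \<Psi> v z = m z / real N * (\<Sum>h=0..M. (\<Sum>i=1..N. v i h) * \<Psi> h z)"
  unfolding total_momentum_def gpc_def sum_distrib_right by (subst sum.swap) (rule refl)

lemma sum_mult_local_mass:
  "(\<Sum>l\<in>B. e l * local_mass m N M \<Psi> cell x l z) =
     m z / real N * (\<Sum>l\<in>B. e l * (\<Sum>i=1..N. indicator (cell l) (gpc M \<Psi> (x i) z)))"
  unfolding local_mass_def by (subst sum_distrib_left) (simp only: mult.left_commute)

theorem proposition1:
  fixes P :: "'w measure" and Z :: "'w \<Rightarrow> real ^ 'd"
    and \<Omega> :: "(real ^ 'd) set" and p :: "real ^ 'd \<Rightarrow> real"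
    and \<Psi> :: "nat \<Rightarrow> real ^ 'd \<Rightarrow> real" and m :: "real ^ 'd \<Rightarrow> real"
    and I :: "real set" and cell :: "nat \<Rightarrow> real set"
    and \<zeta> :: "nat \<Rightarrow> real ^ 'd" and w :: "nat \<Rightarrow> real"
    and E :: "nat \<Rightarrow> real ^ 'd \<Rightarrow> real"
    and x v x_half x_new v_new :: "nat \<Rightarrow> nat \<Rightarrow> real"
    and dt :: real and M N L K :: nat
  assumes "prob_space P"
    and "\<Omega> \<in> sets borel"
    and "\<forall>\<omega>\<in>space P. Z \<omega> \<in> \<Omega>"
    and "\<forall>z. 0 \<le> p z"
    and "distributed P lborel Z (\<lambda>z. ennreal (p z))"
    and "orthonormal_polys \<Omega> p M \<Psi>"
    and "1 \<le> L" and "equispaced_cells I L cell"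
    and "1 \<le> N" and "0 < dt"
    and "\<forall>z\<in>\<Omega>. 0 < m z"
    and "1 \<le> K" and "gauss_rule \<Omega> p K \<zeta> w"
    and "sg_transport_step dt N M \<Psi> L cell K \<zeta> w E x v x_half x_new v_new"
    and "\<forall>k\<in>{1..K}. (\<Sum>l=1..L. E l (\<zeta> k) * local_mass m N M \<Psi> cell x_half l (\<zeta> k)) = 0"
  shows "\<forall>z\<in>\<Omega>. total_momentum m N M \<Psi> v_new z = total_momentum m N M \<Psi> v z"
proof -
  have force: "(\<Sum>l=1..L. E l (\<zeta> k) *
      (\<Sum>i=1..N. indicator (cell l) (gpc M \<Psi> (x_half i) (\<zeta> k)))) = 0" if k: "k \<in> {1..K}" for k
  proof -
    \<comment> \<open>Nodes of the rule lie in \<open>\<Omega>\<close>, where the mass is positive;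
      the common factor can thus be cancelled from the solver condition.\<close>
    have "0 < m (\<zeta> k)"
      using \<open>gauss_rule \<Omega> p K \<zeta> w\<close> \<open>\<forall>z\<in>\<Omega>. 0 < m z\<close> k by (auto simp: gauss_rule_def)
    then have "m (\<zeta> k) / real N \<noteq> 0"
      using \<open>1 \<le> N\<close> by simp
    then show ?thesis
      using assms(15)[rule_format, OF k] unfolding sum_mult_local_mass by (simp only: mult_eq_0_iff) simp
  qed
  \<comment> \<open>Conservation holds mode by mode, not only for the momentum as a function of
    z.\<close>
  have "(\<Sum>i=1..N. v_new i h) = (\<Sum>i=1..N. v i h)" if "h \<in> {0..M}" for h
  proof -
    have "(\<Sum>i=1..N. v_new i h) = (\<Sum>i=1..N. v i h + dt * (\<Sum>l=1..L. quadrature K \<zeta> w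
        (\<lambda>z. E l z * indicator (cell l) (gpc M \<Psi> (x_half i) z) * \<Psi> h z)))"
      using assms(14) that unfolding sg_transport_step_def by (intro sum.cong refl) blast
    also have "\<dots> = (\<Sum>i=1..N. v i h)"
      unfolding sum.distrib sum_distrib_left[symmetric] sum_quadrature_swap
      \<comment> \<open>Keeping \<open>1\<close> unexpanded lets the index ranges match those in
        \<open>force\<close>, which kills the summand of every node.\<close>
      by (simp add: force del: One_nat_def)
    finally show ?thesis .
  qed
  then show ?thesis
    by (simp add: total_momentum_eq)
qed

end
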